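(* Let $(R_i)_{i\in S}$ be a family of nonzero commutative rings indexed by a set $S$, let $R=\prod_{i\in S}R_i$ and let $I=\bigoplus_{i\in S}R_i$ be the direct sum ideal of $R$. Then the set of wild primes of $R$ is the closed subset $V(I)=\{\mathfrak p\in\operatorname{Spec}(R): I\subseteq\mathfrak p\}$ of $\operatorname{Spec}(R)$.
   Context: All rings are commutative with identity. For $k\in S$, $\pi_k:R\to R_k$ denotes the projection map. A tame prime of $R=\prod_{i\in S}R_i$ is a prime ideal of $R$ of the form $\pi_k^{-1}(\mathfrak p)$ for some $k\in S$ and some prime ideal $\mathfrak p$ of $R_k$. A wild prime of $R$ is a prime ideal of $R$ which is not tame. The direct sum ideal $\bigoplus_{i\in S}R_i$ is the set of all $(r_i)\in R$ with $r_i=0$ for all but finitely many $i$. *)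

theory Defs
  imports
    "HOL-Algebra.Ideal"
    "HOL-Algebra.Product_Groups"
    "HOL-Analysis.Abstract_Topology"
begin

section \<open>Products of families of rings\<close>

definition product_ring :: "'i set \<Rightarrow> ('i \<Rightarrow> ('a, 'm) ring_scheme) \<Rightarrow> ('i \<Rightarrow> 'a) ring"
  where "product_ring S R = monoid.extend (product_group S R)
           \<lparr> zero = one (product_group S (\<lambda>i. add_monoid (R i))),
             add = mult (product_group S (\<lambda>i. add_monoid (R i))) \<rparr>"

lemma product_ring_simps [simp]:
  "carrier (product_ring S R) = (\<Pi>\<^sub>E i\<in>S. carrier (R i))"
  "\<one>\<^bsub>product_ring S R\<^esub> = (\<lambda>i\<in>S. \<one>\<^bsub>R i\<^esub>)"
  "\<zero>\<^bsub>product_ring S R\<^esub> = (\<lambda>i\<in>S. \<zero>\<^bsub>R i\<^esub>)"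
  "x \<otimes>\<^bsub>product_ring S R\<^esub> y = (\<lambda>i\<in>S. x i \<otimes>\<^bsub>R i\<^esub> y i)"
  "x \<oplus>\<^bsub>product_ring S R\<^esub> y = (\<lambda>i\<in>S. x i \<oplus>\<^bsub>R i\<^esub> y i)"
  by (simp_all add: product_ring_def monoid.defs)

lemma cring_product_ring:
  assumes "\<And>i. i \<in> S \<Longrightarrow> cring (R i)"
  shows "cring (product_ring S R)"
proof (rule cringI)
  have r_one: "x \<otimes>\<^bsub>R i\<^esub> \<one>\<^bsub>R i\<^esub> = x" if "i \<in> S" "x \<in> carrier (R i)" for i x
    using that assms by (meson cring.axioms(1) monoid.r_one ring.axioms(2))
  show "abelian_group (product_ring S R)"
  proof (rule abelian_groupI)
    fix x assume x: "x \<in> carrier (product_ring S R)"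
    have "(\<lambda>i\<in>S. \<ominus>\<^bsub>R i\<^esub> x i) \<in> carrier (product_ring S R)"
      using x assms by (auto simp: PiE_iff cring.cring_simprules)
    moreover have "(\<lambda>i\<in>S. \<ominus>\<^bsub>R i\<^esub> x i) \<oplus>\<^bsub>product_ring S R\<^esub> x = \<zero>\<^bsub>product_ring S R\<^esub>"
      using x assms by (auto simp: PiE_iff cring.cring_simprules)
    ultimately show "\<exists>y\<in>carrier (product_ring S R). y \<oplus>\<^bsub>product_ring S R\<^esub> x = \<zero>\<^bsub>product_ring S R\<^esub>"
      by blast
  qed (use assms in \<open>auto simp: PiE_iff cring.cring_simprules extensional_def\<close>)
  show "comm_monoid (product_ring S R)"
    by (rule comm_monoidI)
      (use assms in \<open>auto simp: r_one PiE_iff cring.cring_simprules extensional_def fun_eq_iff\<close>)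
qed (use assms in \<open>auto simp: PiE_iff cring.cring_simprules extensional_def fun_eq_iff\<close>)

definition product_proj :: "'i \<Rightarrow> ('i \<Rightarrow> 'a) \<Rightarrow> 'a"
  where "product_proj k = (\<lambda>x. x k)"

lemma product_proj_ring_hom:
  assumes "k \<in> S"
  shows "product_proj k \<in> ring_hom (product_ring S R) (R k)"
  using assms by (auto simp: ring_hom_def product_proj_def)

definition direct_sum :: "'i set \<Rightarrow> ('i \<Rightarrow> ('a, 'm) ring_scheme) \<Rightarrow> ('i \<Rightarrow> 'a) set"
  where "direct_sum S R =
    {r \<in> carrier (product_ring S R). finite {i \<in> S. r i \<noteq> \<zero>\<^bsub>R i\<^esub>}}"

lemma ideal_direct_sum:
  assumes "\<And>i. i \<in> S \<Longrightarrow> cring (R i)"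
  shows "ideal (direct_sum S R) (product_ring S R)"
proof (rule idealI)
  interpret P: cring "product_ring S R" by (rule cring_product_ring) (rule assms)
  show "ring (product_ring S R)" ..
  have "subgroup {x \<in> \<Pi>\<^sub>E i\<in>S. carrier (add_monoid (R i)). finite {i \<in> S. x i \<noteq> \<one>\<^bsub>add_monoid (R i)\<^esub>}}
      (product_group S (\<lambda>i. add_monoid (R i)))"
    by (rule subgroup_sum_group) (use assms abelian_group.a_group cring.axioms(1) ring.is_abelian_group in blast)
  moreover have "add_monoid (product_ring S R) = product_group S (\<lambda>i. add_monoid (R i))"
    by (simp add: product_ring_def product_group_def monoid.defs)
  ultimately show "subgroup (direct_sum S R) (add_monoid (product_ring S R))"
    by (simp add: direct_sum_def)
next
  fix a x assume a: "a \<in> direct_sum S R" and x: "x \<in> carrier (product_ring S R)"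
  have "x i \<otimes>\<^bsub>R i\<^esub> \<zero>\<^bsub>R i\<^esub> = \<zero>\<^bsub>R i\<^esub>" "\<zero>\<^bsub>R i\<^esub> \<otimes>\<^bsub>R i\<^esub> x i = \<zero>\<^bsub>R i\<^esub>" if "i \<in> S" for i
    using that x assms by (auto simp: PiE_iff cring.cring_simprules)
  then have "{i \<in> S. x i \<otimes>\<^bsub>R i\<^esub> a i \<noteq> \<zero>\<^bsub>R i\<^esub>} \<subseteq> {i \<in> S. a i \<noteq> \<zero>\<^bsub>R i\<^esub>}"
    "{i \<in> S. a i \<otimes>\<^bsub>R i\<^esub> x i \<noteq> \<zero>\<^bsub>R i\<^esub>} \<subseteq> {i \<in> S. a i \<noteq> \<zero>\<^bsub>R i\<^esub>}"
    by auto
  moreover have "finite {i \<in> S. a i \<noteq> \<zero>\<^bsub>R i\<^esub>}" using a by (simp add: direct_sum_def)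
  ultimately have "finite {i \<in> S. x i \<otimes>\<^bsub>R i\<^esub> a i \<noteq> \<zero>\<^bsub>R i\<^esub>}"
    "finite {i \<in> S. a i \<otimes>\<^bsub>R i\<^esub> x i \<noteq> \<zero>\<^bsub>R i\<^esub>}"
    by (auto intro: finite_subset)
  with a x assms show "x \<otimes>\<^bsub>product_ring S R\<^esub> a \<in> direct_sum S R"
    "a \<otimes>\<^bsub>product_ring S R\<^esub> x \<in> direct_sum S R"
    by (auto simp: direct_sum_def PiE_iff cring.cring_simprules cong: conj_cong)
qed

section \<open>The prime spectrum\<close>

definition Spec :: "('a, 'm) ring_scheme \<Rightarrow> 'a set set"
  where "Spec R = {p. primeideal p R}"

definition vanishing_set :: "('a, 'm) ring_scheme \<Rightarrow> 'a set \<Rightarrow> 'a set set"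
  where "vanishing_set R E = {p \<in> Spec R. E \<subseteq> p}"

definition zariski_topology :: "('a, 'm) ring_scheme \<Rightarrow> 'a set topology"
  where "zariski_topology R =
    topology (\<lambda>U. \<exists>E \<subseteq> carrier R. U = Spec R - vanishing_set R E)"

lemma vanishing_set_Un:
  assumes "E \<subseteq> carrier R" "F \<subseteq> carrier R"
  shows "vanishing_set R E \<union> vanishing_set R F =
         vanishing_set R {a \<otimes>\<^bsub>R\<^esub> b | a b. a \<in> E \<and> b \<in> F}" (is "?L = ?M")
proof (intro equalityI subsetI)
  fix p assume "p \<in> ?L"
  then have p: "primeideal p R" and EF: "E \<subseteq> p \<or> F \<subseteq> p"
    by (auto simp: vanishing_set_def Spec_def)
  interpret primeideal p R by (rule p)
  show "p \<in> ?M"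
    using p EF assms I_l_closed I_r_closed
    unfolding vanishing_set_def Spec_def by blast
next
  fix p assume "p \<in> ?M"
  then have p: "primeideal p R" and EF: "\<And>a b. a \<in> E \<Longrightarrow> b \<in> F \<Longrightarrow> a \<otimes>\<^bsub>R\<^esub> b \<in> p"
    by (auto simp: vanishing_set_def Spec_def)
  interpret primeideal p R by (rule p)
  have "E \<subseteq> p \<or> F \<subseteq> p"
    using EF I_prime assms by (meson subset_iff)
  then show "p \<in> ?L" using p by (auto simp: vanishing_set_def Spec_def)
qed

lemma istopology_zariski:
  assumes "cring R"
  shows "istopology (\<lambda>U. \<exists>E \<subseteq> carrier R. U = Spec R - vanishing_set R E)"
  unfolding istopology_def
proof (intro conjI allI impI)
  fix U V
  assume "\<exists>E \<subseteq> carrier R. U = Spec R - vanishing_set R E"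
    and "\<exists>E \<subseteq> carrier R. V = Spec R - vanishing_set R E"
  then obtain E F where EF: "E \<subseteq> carrier R" "F \<subseteq> carrier R"
    and "U = Spec R - vanishing_set R E" "V = Spec R - vanishing_set R F" by blast
  then have "U \<inter> V = Spec R - vanishing_set R {a \<otimes>\<^bsub>R\<^esub> b | a b. a \<in> E \<and> b \<in> F}"
    using vanishing_set_Un [OF EF] by blast
  moreover have "{a \<otimes>\<^bsub>R\<^esub> b | a b. a \<in> E \<and> b \<in> F} \<subseteq> carrier R"
    using EF cring.cring_simprules(5)[OF assms] by blast
  ultimately show "\<exists>E \<subseteq> carrier R. U \<inter> V = Spec R - vanishing_set R E" by blast
next
  fix \<U> assume "\<forall>U\<in>\<U>. \<exists>E \<subseteq> carrier R. U = Spec R - vanishing_set R E"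
  then obtain E where E: "\<And>U. U \<in> \<U> \<Longrightarrow> E U \<subseteq> carrier R \<and> U = Spec R - vanishing_set R (E U)"
    by metis
  have "\<Union>\<U> = (\<Union>U\<in>\<U>. Spec R - vanishing_set R (E U))"
    using E by (metis (no_types, lifting) SUP_cong image_ident)
  also have "\<dots> = Spec R - vanishing_set R (\<Union>U\<in>\<U>. E U)"
    by (auto simp: vanishing_set_def)
  finally show "\<exists>E \<subseteq> carrier R. \<Union>\<U> = Spec R - vanishing_set R E"
    using E by (intro exI[of _ "\<Union>U\<in>\<U>. E U"]) auto
qed

lemma openin_zariski:
  assumes "cring R"
  shows "openin (zariski_topology R) U \<longleftrightarrow> (\<exists>E \<subseteq> carrier R. U = Spec R - vanishing_set R E)"
  unfolding zariski_topology_def using topology_inverse' [OF istopology_zariski [OF assms]] by simp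

lemma topspace_zariski:
  assumes "cring R"
  shows "topspace (zariski_topology R) = Spec R"
proof -
  have "Spec R - vanishing_set R (carrier R) = Spec R"
    using ideal.Icarr
    by (auto simp: vanishing_set_def Spec_def dest: primeideal.I_notcarr
        intro: ideal.Icarr[OF primeideal.axioms(1)])
  then show ?thesis
    unfolding topspace_def openin_zariski [OF assms] by blast
qed

lemma closedin_zariski:
  assumes "cring R"
  shows "closedin (zariski_topology R) C \<longleftrightarrow> (\<exists>E \<subseteq> carrier R. C = vanishing_set R E)"
proof -
  have "vanishing_set R E \<subseteq> Spec R" for E by (auto simp: vanishing_set_def)
  then show ?thesis
    unfolding closedin_def openin_zariski [OF assms] topspace_zariski [OF assms]
    by (metis Diff_subset double_diff subset_refl)
qed

section \<open>Tame and wild primes\<close>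

definition tame_prime :: "'i set \<Rightarrow> ('i \<Rightarrow> ('a, 'm) ring_scheme) \<Rightarrow> ('i \<Rightarrow> 'a) set \<Rightarrow> bool"
  where "tame_prime S R P \<longleftrightarrow> P \<in> Spec (product_ring S R) \<and>
    (\<exists>k \<in> S. \<exists>\<pp> \<in> Spec (R k). P = product_proj k -` \<pp> \<inter> carrier (product_ring S R))"

definition wild_prime :: "'i set \<Rightarrow> ('i \<Rightarrow> ('a, 'm) ring_scheme) \<Rightarrow> ('i \<Rightarrow> 'a) set \<Rightarrow> bool"
  where "wild_prime S R P \<longleftrightarrow> P \<in> Spec (product_ring S R) \<and> \<not> tame_prime S R P"

end

theory Submission
  imports Defs
begin

text \<open>For \<^term>\<open>k \<in> S\<close> let \<open>e\<^sub>k\<close> be the idempotent supported at \<open>k\<close>. A prime that contains every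
  \<open>e\<^sub>k\<close> contains the direct sum, which they generate, while a tame prime over \<open>k\<close> does not contain
  \<open>e\<^sub>k\<close>. Conversely, if a prime \<open>P\<close> omits \<open>e\<^sub>k\<close>, then \<open>x \<in> P\<close> iff \<open>e\<^sub>k x \<in> P\<close>, so membership in
  \<open>P\<close> depends on the coordinate \<open>x k\<close> only and \<open>P\<close> is tame.\<close>

text \<open>The embedding of the factor at \<open>k\<close> as an ideal of the product. It respects
  sums and products but in general not the unit: it sends \<open>\<one>\<close> of
  \<open>R k\<close> to the idempotent \<open>e\<^sub>k\<close>. Restricting to \<open>S\<close>
  keeps the value extensional, as the carrier demands.\<close>

definition product_incl ::
    "'i set \<Rightarrow> ('i \<Rightarrow> ('a, 'm) ring_scheme) \<Rightarrow> 'i \<Rightarrow> 'a \<Rightarrow> 'i \<Rightarrow> 'a"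
  where "product_incl S R k a = (\<lambda>i\<in>S. if i = k then a else \<zero>\<^bsub>R i\<^esub>)"

locale cring_family =
  fixes S :: "'i set" and R :: "'i \<Rightarrow> ('a, 'm) ring_scheme"
  assumes cring_component: "i \<in> S \<Longrightarrow> cring (R i)"
begin

sublocale product: cring "product_ring S R"
  by (intro cring_product_ring cring_component)

lemmas component_simprules = cring_component cring.cring_simprules

lemma product_incl_closed:
  "k \<in> S \<Longrightarrow> a \<in> carrier (R k) \<Longrightarrow> product_incl S R k a \<in> carrier (product_ring S R)"
  by (auto simp: product_incl_def component_simprules)

lemma product_incl_in_direct_sum:
  assumes "k \<in> S" "a \<in> carrier (R k)"
  shows "product_incl S R k a \<in> direct_sum S R"
proof -
  have "{i \<in> S. product_incl S R k a i \<noteq> \<zero>\<^bsub>R i\<^esub>} \<subseteq> {k}"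
    by (auto simp: product_incl_def)
  then have "finite {i \<in> S. product_incl S R k a i \<noteq> \<zero>\<^bsub>R i\<^esub>}"
    by (rule finite_subset) simp
  then show ?thesis
    using product_incl_closed [OF assms] unfolding direct_sum_def by blast
qed

lemma product_incl_add:
  "k \<in> S \<Longrightarrow> a \<in> carrier (R k) \<Longrightarrow> b \<in> carrier (R k) \<Longrightarrow>
    product_incl S R k (a \<oplus>\<^bsub>R k\<^esub> b) =
    product_incl S R k a \<oplus>\<^bsub>product_ring S R\<^esub> product_incl S R k b"
  by (auto simp: product_incl_def component_simprules)

lemma product_incl_zero: "product_incl S R k \<zero>\<^bsub>R k\<^esub> = \<zero>\<^bsub>product_ring S R\<^esub>"
  by (auto simp: product_incl_def)

lemma product_incl_mult_left:
  "k \<in> S \<Longrightarrow> a \<in> carrier (R k) \<Longrightarrow> x \<in> carrier (product_ring S R) \<Longrightarrow>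
    product_incl S R k a \<otimes>\<^bsub>product_ring S R\<^esub> x = product_incl S R k (a \<otimes>\<^bsub>R k\<^esub> x k)"
  by (auto simp: product_incl_def component_simprules PiE_iff)

lemma product_incl_mult:
  "k \<in> S \<Longrightarrow> a \<in> carrier (R k) \<Longrightarrow> b \<in> carrier (R k) \<Longrightarrow>
    product_incl S R k (a \<otimes>\<^bsub>R k\<^esub> b) =
    product_incl S R k a \<otimes>\<^bsub>product_ring S R\<^esub> product_incl S R k b"
  by (auto simp: product_incl_def component_simprules)

text \<open>Multiplying by \<open>e\<^sub>k\<close> erases every coordinate except the one at
  \<open>k\<close>. This identity serves both to generate the direct sum and to recognise tame
  primes.\<close>

lemma one_incl_mult:
  assumes "k \<in> S" "x \<in> carrier (product_ring S R)"
  shows "product_incl S R k \<one>\<^bsub>R k\<^esub> \<otimes>\<^bsub>product_ring S R\<^esub> x = product_incl S R k (x k)"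
proof -
  interpret Rk: cring "R k" by (rule cring_component [OF assms(1)])
  have "x k \<in> carrier (R k)" using assms by auto
  then show ?thesis
    using product_incl_mult_left [OF assms(1) Rk.one_closed assms(2)] by (simp only: Rk.l_one)
qed

lemma direct_sum_subset_ideal:
  assumes P: "ideal P (product_ring S R)"
    and one_incl: "\<And>k. k \<in> S \<Longrightarrow> product_incl S R k \<one>\<^bsub>R k\<^esub> \<in> P"
  shows "direct_sum S R \<subseteq> P"
proof -
  interpret P: ideal P "product_ring S R" by (rule P)
  \<comment> \<open>The finite set \<open>F\<close> only bounds the support of \<open>r\<close>, and
    \<open>r\<close> stays arbitrary, so that the induction can clear one coordinate at a
    time.\<close>
  have "r \<in> P" if "finite F" "r \<in> carrier (product_ring S R)"
    "{i \<in> S. r i \<noteq> \<zero>\<^bsub>R i\<^esub>} \<subseteq> F" for F r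
    using that
  proof (induction F arbitrary: r rule: finite_induct)
    case empty
    then have "r = \<zero>\<^bsub>product_ring S R\<^esub>"
      by (intro ext) (auto simp: PiE_iff extensional_def)
    then show ?case using P.zero_closed by (simp only:)
  next
    case (insert k F)
    show ?case
    proof (cases "k \<in> S")
      case True
      \<comment> \<open>Clearing the coordinate at \<open>k\<close> shrinks the support into
        \<open>F\<close>; the removed summand is \<open>e\<^sub>k\<close> times \<open>r\<close>,
        hence in \<open>P\<close>.\<close>
      define s where "s = (\<lambda>i\<in>S. if i = k then \<zero>\<^bsub>R i\<^esub> else r i)"
      have "s \<in> carrier (product_ring S R)"
        using insert.prems(1) cring_component
        by (auto simp: s_def PiE_iff intro: cring.cring_simprules)
      moreover have "{i \<in> S. s i \<noteq> \<zero>\<^bsub>R i\<^esub>} \<subseteq> F"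
        using insert.prems(2) by (auto simp: s_def)
      ultimately have "s \<in> P" by (rule insert.IH)
      moreover have "product_incl S R k (r k) \<in> P"
        using P.I_r_closed [OF one_incl [OF True] insert.prems(1)]
          one_incl_mult [OF True insert.prems(1)] by (simp only:)
      moreover have "r = product_incl S R k (r k) \<oplus>\<^bsub>product_ring S R\<^esub> s"
        using insert.prems(1)
        by (intro ext)
          (auto simp: product_incl_def s_def component_simprules PiE_iff extensional_def)
      ultimately show ?thesis by (metis P.a_closed)
    next
      \<comment> \<open>An index outside \<open>S\<close> carries no support, so \<open>F\<close>
        already bounds it.\<close>
      case False
      with insert.prems show ?thesis by (intro insert.IH) auto
    qed
  qed
  then show ?thesis by (auto simp: direct_sum_def)
qed

text \<open>Pulling back along an additive and multiplicative map preserves absorption and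
  primality. Properness could fail because the unit is not preserved; the assumption on
  \<open>e\<^sub>k\<close> says exactly that \<open>\<one>\<close> stays outside the
  preimage.\<close>

lemma primeideal_incl_vimage:
  assumes P: "primeideal P (product_ring S R)" and k: "k \<in> S"
    and one_incl: "product_incl S R k \<one>\<^bsub>R k\<^esub> \<notin> P"
  shows "primeideal {a \<in> carrier (R k). product_incl S R k a \<in> P} (R k)" (is "primeideal ?p _")
proof -
  interpret P: primeideal P "product_ring S R" by (rule P)
  interpret Rk: cring "R k" by (rule cring_component [OF k])
  have mult: "x \<otimes>\<^bsub>R k\<^esub> a \<in> ?p" if "a \<in> ?p" "x \<in> carrier (R k)" for a x
    using that P.I_l_closed product_incl_closed [OF k] product_incl_mult [OF k]
    by (metis (mono_tags, lifting) Rk.m_closed mem_Collect_eq)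
  have "subgroup ?p (add_monoid (R k))"
  proof (rule Rk.add.subgroupI)
    show "?p \<noteq> {}"
      using product_incl_zero P.zero_closed Rk.zero_closed
      by (metis (mono_tags, lifting) empty_iff mem_Collect_eq)
    fix a assume a: "a \<in> ?p"
    \<comment> \<open>Writing the negative as a multiple by minus one reduces this closure to
      absorption.\<close>
    then have "\<ominus>\<^bsub>R k\<^esub> a = (\<ominus>\<^bsub>R k\<^esub> \<one>\<^bsub>R k\<^esub>) \<otimes>\<^bsub>R k\<^esub> a" by (simp add: Rk.l_minus)
    then show "\<ominus>\<^bsub>R k\<^esub> a \<in> ?p" using mult [OF a] by simp
    fix b assume "b \<in> ?p"
    with a show "a \<oplus>\<^bsub>R k\<^esub> b \<in> ?p"
      using P.a_closed product_incl_add [OF k] by (auto simp del: product_ring_simps)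
  qed auto
  then have "ideal ?p (R k)"
    using mult Rk.m_comm by (intro idealI Rk.ring_axioms) (auto simp del: product_ring_simps)
  moreover have "carrier (R k) \<noteq> ?p" using one_incl by blast
  moreover have "a \<in> ?p \<or> b \<in> ?p"
    if ab: "a \<in> carrier (R k)" "b \<in> carrier (R k)" "a \<otimes>\<^bsub>R k\<^esub> b \<in> ?p" for a b
  proof -
    have "product_incl S R k a \<otimes>\<^bsub>product_ring S R\<^esub> product_incl S R k b \<in> P"
      using ab product_incl_mult [OF k] by (auto simp del: product_ring_simps)
    then show ?thesis using P.I_prime ab product_incl_closed [OF k] by blast
  qed
  ultimately show ?thesis by (intro primeidealI Rk.is_cring)
qed

lemma tame_prime_if_one_incl_notin:
  assumes P: "primeideal P (product_ring S R)" and k: "k \<in> S"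
    and one_incl: "product_incl S R k \<one>\<^bsub>R k\<^esub> \<notin> P"
  shows "tame_prime S R P"
proof -
  interpret P: primeideal P "product_ring S R" by (rule P)
  let ?p = "{a \<in> carrier (R k). product_incl S R k a \<in> P}"
  have one: "product_incl S R k \<one>\<^bsub>R k\<^esub> \<in> carrier (product_ring S R)"
    using k by (intro product_incl_closed) (auto simp: component_simprules)
  \<comment> \<open>Since \<open>product_incl S R k (x k)\<close> is \<open>e\<^sub>k\<close> times
    \<open>x\<close>, one direction is absorption and the other is primality with
    \<open>e\<^sub>k\<close> outside \<open>P\<close>.\<close>
  have "x \<in> P \<longleftrightarrow> product_incl S R k (x k) \<in> P" if "x \<in> carrier (product_ring S R)" for x
    using P.I_l_closed [OF _ one] P.I_prime [OF one that] one_incl one_incl_mult [OF k that]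
    by metis
  moreover have "x k \<in> carrier (R k)" if "x \<in> carrier (product_ring S R)" for x
    using that k by auto
  ultimately have "P = product_proj k -` ?p \<inter> carrier (product_ring S R)"
    using P.Icarr unfolding product_proj_def by blast
  moreover have "?p \<in> Spec (R k)"
    using primeideal_incl_vimage [OF assms] by (simp add: Spec_def)
  ultimately show ?thesis using P k unfolding tame_prime_def Spec_def by blast
qed

lemma not_direct_sum_subset_tame_prime:
  assumes "tame_prime S R P"
  shows "\<not> direct_sum S R \<subseteq> P"
proof
  assume "direct_sum S R \<subseteq> P"
  obtain k p where k: "k \<in> S" and p: "primeideal p (R k)"
    and P: "P = product_proj k -` p \<inter> carrier (product_ring S R)"
    using assms by (auto simp: tame_prime_def Spec_def)
  interpret p: primeideal p "R k" by (rule p)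
  have "product_incl S R k \<one>\<^bsub>R k\<^esub> \<in> P"
    using \<open>direct_sum S R \<subseteq> P\<close> product_incl_in_direct_sum [OF k p.one_closed] by blast
  \<comment> \<open>The coordinate of \<open>e\<^sub>k\<close> at \<open>k\<close> is
    \<open>\<one>\<close>, which no proper ideal contains.\<close>
  then have "\<one>\<^bsub>R k\<^esub> \<in> p" using k by (simp add: P product_proj_def product_incl_def)
  then show False using p.one_imp_carrier p.I_notcarr by blast
qed

lemma wild_primes_eq_vanishing_set:
  "{P. wild_prime S R P} = vanishing_set (product_ring S R) (direct_sum S R)"
proof -
  have "tame_prime S R P \<longleftrightarrow> \<not> direct_sum S R \<subseteq> P" if "P \<in> Spec (product_ring S R)" for P
  proof -
    have P: "primeideal P (product_ring S R)" using that by (simp add: Spec_def)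
    show ?thesis
      using direct_sum_subset_ideal [OF primeideal.axioms(1) [OF P]]
        tame_prime_if_one_incl_notin [OF P] not_direct_sum_subset_tame_prime
      by metis
  qed
  then show ?thesis by (auto simp: wild_prime_def vanishing_set_def)
qed

end

theorem corollary2p3:
  fixes S :: "'i set" and R :: "'i \<Rightarrow> ('a, 'm) ring_scheme"
  assumes "\<And>i. i \<in> S \<Longrightarrow> cring (R i)"
    and "\<And>i. i \<in> S \<Longrightarrow> \<one>\<^bsub>R i\<^esub> \<noteq> \<zero>\<^bsub>R i\<^esub>"
  shows "{P. wild_prime S R P} = vanishing_set (product_ring S R) (direct_sum S R) \<and>
    closedin (zariski_topology (product_ring S R)) {P. wild_prime S R P}"
proof -
  interpret cring_family S R by (rule cring_family.intro) (rule assms(1))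
  \<comment> \<open>Closed sets are the vanishing sets of subsets of the carrier; the direct sum is
    the witness.\<close>
  have "direct_sum S R \<subseteq> carrier (product_ring S R)" by (auto simp: direct_sum_def)
  then show ?thesis
    unfolding closedin_zariski [OF product.is_cring] wild_primes_eq_vanishing_set by blast
qed

end
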